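(* There exist a symmetric trilinear form $A\in \mathrm{Sym}^3((\mathbb{R}^4)^* )$ and a symmetric $4$-linear form $B\in \mathrm{Sym}^4((\mathbb{R}^4)^* )$ such that the map $$(q_0,q_1,q_2,q_3)\longmapsto \begin{bmatrix} A(q_1,q_2,q_3)\\ A(q_0,q_2,q_3)\\ A(q_0,q_1,q_3)\\ A(q_0,q_1,q_2)\\ B(q_0,q_1,q_2,q_3)\end{bmatrix}\in\mathbb{R}^5$$ does not have a zero on $O(4)$, i.e. for every orthonormal basis $(q_0,q_1,q_2,q_3)$ of $\mathbb{R}^4$ at least one of the five listed real numbers is nonzero.
   Context: $\mathrm{Sym}^n((\mathbb{R}^4)^* )$ denotes the space of symmetric $n$-linear forms $(\mathbb{R}^4)^n\to\mathbb{R}$. An element of $O(4)$ is identified with the ordered tuple $(q_0,q_1,q_2,q_3)$ of its columns, an orthonormal basis of $\mathbb{R}^4$. *)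

theory Defs
  imports "HOL-Analysis.Analysis"
begin

text \<open>The space of symmetric \<open>n\<close>-linear real forms on \<open>'v\<close>, with \<open>n = CARD('n)\<close>: an
  argument \<open>x :: 'v ^ 'n\<close> is an \<open>n\<close>-tuple of vectors.\<close>

definition sym_forms :: "(('v::real_vector) ^ ('n::finite) \<Rightarrow> real) set" where
  "sym_forms = {f.
     (\<forall>x i. linear (\<lambda>v. f (\<chi> j. if j = i then v else x $ j))) \<and>
     (\<forall>x \<pi>. \<pi> permutes UNIV \<longrightarrow> f (\<chi> j. x $ (\<pi> j)) = f x)}"

text \<open>The columns are \<open>q\<^sub>0, \<dots>, q\<^sub>3\<close>. The elements of the index type \<open>4\<close> are the residues
  0, 1, 2, 3 modulo 4 (so \<open>column 0 Q\<close> and \<open>column 4 Q\<close> are the same column).\<close>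

definition form_map ::
    "((real^4)^3 \<Rightarrow> real) \<Rightarrow> ((real^4)^4 \<Rightarrow> real) \<Rightarrow> real^4^4 \<Rightarrow> real^5" where
  "form_map A B Q =
    (let q0 = column 0 Q; q1 = column 1 Q; q2 = column 2 Q; q3 = column 3 Q in
     vector [A (vector [q1, q2, q3]),
             A (vector [q0, q2, q3]),
             A (vector [q0, q1, q3]),
             A (vector [q0, q1, q2]),
             B (vector [q0, q1, q2, q3])])"

lemma vector_4:
  "(vector [x,y,z,w] :: ('a::zero)^4) $ 1 = x"
  "(vector [x,y,z,w] :: ('a::zero)^4) $ 2 = y"
  "(vector [x,y,z,w] :: ('a::zero)^4) $ 3 = z"
  "(vector [x,y,z,w] :: ('a::zero)^4) $ 4 = w"
  unfolding vector_def by simp_all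

lemma vector_5:
  "(vector [x,y,z,w,v] :: ('a::zero)^5) $ 1 = x"
  "(vector [x,y,z,w,v] :: ('a::zero)^5) $ 2 = y"
  "(vector [x,y,z,w,v] :: ('a::zero)^5) $ 3 = z"
  "(vector [x,y,z,w,v] :: ('a::zero)^5) $ 4 = w"
  "(vector [x,y,z,w,v] :: ('a::zero)^5) $ 5 = v"
  unfolding vector_def by simp_all

lemma exhaust_5:
  fixes i :: 5
  shows "i = 1 \<or> i = 2 \<or> i = 3 \<or> i = 4 \<or> i = 5"
proof (induct i)
  case (of_int z)
  then have "z = 0 \<or> z = 1 \<or> z = 2 \<or> z = 3 \<or> z = 4" by simp arith
  then show ?case by auto
qed

lemma form_map_eq_0_iff:
  "form_map A B Q = 0 \<longleftrightarrow>
     A (vector [column 1 Q, column 2 Q, column 3 Q]) = 0 \<and>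
     A (vector [column 0 Q, column 2 Q, column 3 Q]) = 0 \<and>
     A (vector [column 0 Q, column 1 Q, column 3 Q]) = 0 \<and>
     A (vector [column 0 Q, column 1 Q, column 2 Q]) = 0 \<and>
     B (vector [column 0 Q, column 1 Q, column 2 Q, column 3 Q]) = 0"
proof -
  have "v = 0 \<longleftrightarrow> v $ 1 = 0 \<and> v $ 2 = 0 \<and> v $ 3 = 0 \<and> v $ 4 = 0 \<and> v $ 5 = 0" for v :: "real^5"
    unfolding vec_eq_iff zero_index by (metis exhaust_5)
  then show ?thesis
    by (simp only: form_map_def Let_def vector_5)
qed

end

theory Submission
  imports Defs
begin

text \<open>Write \<open>(x, y, u, v)\<close> for the coordinates of \<open>\<real>\<^sup>4\<close>. The forms are the polarizations (up to scaling) of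
  \<open>v (3 u\<^sup>2 - x\<^sup>2) + 2 e x y u\<close> and \<open>v\<^sup>2 x u\<close>, where \<open>e > 0\<close> is sufficiently small.

  If there were zeros for a sequence of parameters \<open>e\<close> tending to 0, a subsequence would converge to a
  zero for \<open>e = 0\<close>. Such a zero has a column with \<open>x = u = v = 0\<close>. Rescaling the coordinates
  \<open>x, u, v\<close> of this column together with \<open>e\<close> to norm 1 and passing to the limit again yields a
  nontrivial solution \<open>(\<xi>, \<mu>, \<nu>, e)\<close> of a linear system: the remaining columns, an orthonormal
  basis of the \<open>(v, x, u)\<close>-space, diagonalize the quadratic form
  \<open>6 \<mu> u v + 3 \<nu> u\<^sup>2 - 2 \<xi> x v - \<nu> x\<^sup>2 + 2 e x u\<close>, and the polarizations of the two cubics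
  \<open>v (3 u\<^sup>2 - x\<^sup>2)\<close> and \<open>2 \<nu> v x u + \<xi> v\<^sup>2 u + \<mu> v\<^sup>2 x\<close> vanish on it. Expressed in the structure
  constants of the algebra of functions on the three columns, with respect to the basis
  \<open>1, x / v, u / v\<close>, this system reduces to one whose determinant is a positive sum of squares, a contradiction
  (columns with \<open>v = 0\<close> are treated directly).\<close>

section \<open>Orthonormal frames of the (v, x, u)-space and the algebra of functions on
  them\<close>

text \<open>The elements of \<open>I\<close> label columns, and \<open>v\<close>, \<open>x\<close>,
  \<open>u\<close> are the three rows. Orthonormality of columns and of rows are both part of the
  interface, so sums over columns and products of two columns can be evaluated directly.\<close>

locale orthonormal_frame =
  fixes I :: "'a set" and v x u :: "'a \<Rightarrow> real"
  assumes fin: "finite I"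
    and cols: "\<And>i j. i \<in> I \<Longrightarrow> j \<in> I \<Longrightarrow> v i * v j + x i * x j + u i * u j = (if i = j then 1 else 0)"
    and vv: "(\<Sum>i\<in>I. v i * v i) = 1" and xx: "(\<Sum>i\<in>I. x i * x i) = 1" and uu: "(\<Sum>i\<in>I. u i * u i) = 1"
    and vx: "(\<Sum>i\<in>I. v i * x i) = 0" and vu: "(\<Sum>i\<in>I. v i * u i) = 0" and xu: "(\<Sum>i\<in>I. x i * u i) = 0"
begin

lemma xv: "(\<Sum>i\<in>I. x i * v i) = 0" and uv: "(\<Sum>i\<in>I. u i * v i) = 0" and ux: "(\<Sum>i\<in>I. u i * x i) = 0"
  using vx vu xu by (simp_all only: mult.commute)

lemmas row_products = vv xx uu vx vu xu xv uv ux

text \<open>By \<open>cols\<close>, the kernel v(i) v(j) + x(i) x(j) + u(i) u(j) is the Kronecker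
  delta, so the rows form an orthonormal basis of the functions on \<open>I\<close>, and this is the
  expansion in that basis.\<close>

lemma expand:
  assumes "i \<in> I"
  shows "f i = (\<Sum>j\<in>I. f j * v j) * v i + (\<Sum>j\<in>I. f j * x j) * x i + (\<Sum>j\<in>I. f j * u j) * u i"
proof -
  have "f i = (\<Sum>j\<in>I. f j * (if i = j then 1 else 0))"
    using assms fin by (simp add: if_distrib cong: if_cong)
  also have "\<dots> = (\<Sum>j\<in>I. f j * (v i * v j + x i * x j + u i * u j))"
    using assms by (intro sum.cong refl) (simp add: cols)
  also have "\<dots> = (\<Sum>j\<in>I. f j * v j) * v i + (\<Sum>j\<in>I. f j * x j) * x i + (\<Sum>j\<in>I. f j * u j) * u i"
    by (simp only: sum_distrib_right sum.distrib[symmetric]) (intro sum.cong refl, simp add: algebra_simps)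
  finally show ?thesis .
qed

text \<open>The bilinear form with matrix \<open>((0, \<alpha>, \<beta>), (\<alpha>, r, e), (\<beta>, e, t))\<close> in the coordinates \<open>(v, x, u)\<close>.\<close>

definition qform :: "real \<Rightarrow> real \<Rightarrow> real \<Rightarrow> real \<Rightarrow> real \<Rightarrow> 'a \<Rightarrow> 'a \<Rightarrow> real" where
  "qform \<alpha> \<beta> r t e i j = \<alpha> * (x i * v j + v i * x j) + \<beta> * (u i * v j + v i * u j)
     + r * x i * x j + t * u i * u j + e * (x i * u j + u i * x j)"

text \<open>A frame that diagonalizes a symmetric form consists of eigenvectors of its matrix: the
  function \<open>qform\<close> at (i, j) of j is l times the delta at i, and pairing it with each
  row gives one coordinate of the eigenvector equation.\<close>

lemma qform_eigen:
  assumes diag: "\<And>i j. i \<in> I \<Longrightarrow> j \<in> I \<Longrightarrow> i \<noteq> j \<Longrightarrow> qform \<alpha> \<beta> r t e i j = 0" and i: "i \<in> I"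
  defines "l \<equiv> qform \<alpha> \<beta> r t e i i"
  shows "l * v i = \<alpha> * x i + \<beta> * u i" "l * x i = \<alpha> * v i + r * x i + e * u i"
    "l * u i = \<beta> * v i + e * x i + t * u i"
proof -
  have *: "l * w i = \<alpha> * (x i * (\<Sum>j\<in>I. v j * w j) + v i * (\<Sum>j\<in>I. x j * w j))
      + \<beta> * (u i * (\<Sum>j\<in>I. v j * w j) + v i * (\<Sum>j\<in>I. u j * w j))
      + r * x i * (\<Sum>j\<in>I. x j * w j) + t * u i * (\<Sum>j\<in>I. u j * w j)
      + e * (x i * (\<Sum>j\<in>I. u j * w j) + u i * (\<Sum>j\<in>I. x j * w j))" for w :: "'a \<Rightarrow> real"
  proof -
    have "(\<Sum>j\<in>I. qform \<alpha> \<beta> r t e i j * w j) = (\<Sum>j\<in>I. if j = i then l * w i else 0)"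
      using diag[OF i] by (intro sum.cong refl) (auto simp: l_def)
    then have "l * w i = (\<Sum>j\<in>I. qform \<alpha> \<beta> r t e i j * w j)"
      using fin i by simp
    also have "\<dots> = (\<Sum>j\<in>I. \<alpha> * x i * (v j * w j) + \<alpha> * v i * (x j * w j) + \<beta> * u i * (v j * w j)
       + \<beta> * v i * (u j * w j) + r * x i * (x j * w j) + t * u i * (u j * w j)
       + e * x i * (u j * w j) + e * u i * (x j * w j))"
      by (intro sum.cong refl) (simp add: qform_def algebra_simps)
    also have "\<dots> = \<alpha> * x i * (\<Sum>j\<in>I. v j * w j) + \<alpha> * v i * (\<Sum>j\<in>I. x j * w j)
       + \<beta> * u i * (\<Sum>j\<in>I. v j * w j) + \<beta> * v i * (\<Sum>j\<in>I. u j * w j)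
       + r * x i * (\<Sum>j\<in>I. x j * w j) + t * u i * (\<Sum>j\<in>I. u j * w j)
       + e * x i * (\<Sum>j\<in>I. u j * w j) + e * u i * (\<Sum>j\<in>I. x j * w j)"
      by (simp only: sum.distrib sum_distrib_left[symmetric])
    finally show ?thesis by (simp add: algebra_simps)
  qed
  show "l * v i = \<alpha> * x i + \<beta> * u i" using *[of v] by (simp add: row_products)
  show "l * x i = \<alpha> * v i + r * x i + e * u i" using *[of x] by (simp add: row_products)
  show "l * u i = \<beta> * v i + e * x i + t * u i" using *[of u] by (simp add: row_products)
qed

text \<open>The functions \<open>1, x / v, u / v\<close> are orthonormal for the weights \<open>v\<^sup>2\<close>, and \<open>k1, \<dots>, k4\<close> are the
  structure constants of pointwise multiplication; the relation between them is associativity.\<close>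

lemma structure_constants:
  assumes nz: "\<And>i. i \<in> I \<Longrightarrow> v i \<noteq> 0"
  obtains k1 k2 k3 k4 where
    "\<And>i. i \<in> I \<Longrightarrow> (x i / v i)\<^sup>2 = 1 + k1 * (x i / v i) + k2 * (u i / v i)"
    "\<And>i. i \<in> I \<Longrightarrow> (x i / v i) * (u i / v i) = k2 * (x i / v i) + k3 * (u i / v i)"
    "\<And>i. i \<in> I \<Longrightarrow> (u i / v i)\<^sup>2 = 1 + k3 * (x i / v i) + k4 * (u i / v i)"
    "(\<Sum>i\<in>I. x i / v i) = k1 + k3" "(\<Sum>i\<in>I. u i / v i) = k2 + k4"
    "k2\<^sup>2 + k3\<^sup>2 - k1 * k3 - k2 * k4 = 1"
    "\<And>\<alpha> \<beta> r t e. (\<And>i j. i \<in> I \<Longrightarrow> j \<in> I \<Longrightarrow> i \<noteq> j \<Longrightarrow> qform \<alpha> \<beta> r t e i j = 0) \<Longrightarrow>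
       r = \<alpha> * k1 + \<beta> * k2 \<and> e = \<alpha> * k2 + \<beta> * k3 \<and> t = \<alpha> * k3 + \<beta> * k4"
proof -
  \<comment> \<open>These are the weighted means of X^3, X^2 U, X U^2, U^3 for X = x/v, U = u/v and
    weights v^2. The symmetry of such triple products is why four constants suffice.\<close>
  define k1 where "k1 = (\<Sum>j\<in>I. x j ^ 3 / v j)"
  define k2 where "k2 = (\<Sum>j\<in>I. x j ^ 2 * u j / v j)"
  define k3 where "k3 = (\<Sum>j\<in>I. x j * u j ^ 2 / v j)"
  define k4 where "k4 = (\<Sum>j\<in>I. u j ^ 3 / v j)"
  note k_defs = k1_def k2_def k3_def k4_def
  have 1: "(x i / v i)\<^sup>2 = 1 + k1 * (x i / v i) + k2 * (u i / v i)" if i: "i \<in> I" for i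
  proof -
    have "(\<Sum>j\<in>I. x j ^ 2 / v j * v j) = 1"
      unfolding xx[symmetric] by (intro sum.cong refl) (simp add: nz power2_eq_square)
    then have "x i ^ 2 / v i = v i + k1 * x i + k2 * u i"
      using expand[OF i, of "\<lambda>j. x j ^ 2 / v j"] by (simp add: k_defs power2_eq_square power3_eq_cube)
    then show ?thesis using nz[OF i] by (simp add: field_simps power2_eq_square)
  qed
  have 2: "(x i / v i) * (u i / v i) = k2 * (x i / v i) + k3 * (u i / v i)" if i: "i \<in> I" for i
  proof -
    have "(\<Sum>j\<in>I. x j * u j / v j * v j) = 0"
      unfolding xu[symmetric] by (intro sum.cong refl) (simp add: nz)
    moreover have "(\<Sum>j\<in>I. x j * u j / v j * x j) = k2" "(\<Sum>j\<in>I. x j * u j / v j * u j) = k3"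
      unfolding k_defs by (intro sum.cong refl, simp add: power2_eq_square)+
    ultimately have "x i * u i / v i = k2 * x i + k3 * u i"
      using expand[OF i, of "\<lambda>j. x j * u j / v j"] by simp
    then show ?thesis using nz[OF i] by (simp add: field_simps)
  qed
  have 3: "(u i / v i)\<^sup>2 = 1 + k3 * (x i / v i) + k4 * (u i / v i)" if i: "i \<in> I" for i
  proof -
    have "(\<Sum>j\<in>I. u j ^ 2 / v j * v j) = 1"
      unfolding uu[symmetric] by (intro sum.cong refl) (simp add: nz power2_eq_square)
    moreover have "(\<Sum>j\<in>I. u j ^ 2 / v j * x j) = k3" "(\<Sum>j\<in>I. u j ^ 2 / v j * u j) = k4"
      unfolding k_defs by (intro sum.cong refl, simp add: power2_eq_square power3_eq_cube)+
    ultimately have "u i ^ 2 / v i = v i + k3 * x i + k4 * u i"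
      using expand[OF i, of "\<lambda>j. u j ^ 2 / v j"] by simp
    then show ?thesis using nz[OF i] by (simp add: field_simps power2_eq_square)
  qed
  have unit: "x i * x i + u i * u i = 1 - v i * v i" if "i \<in> I" for i
    using cols[OF that that] by simp
  \<comment> \<open>This is the trace of multiplication by X in the basis 1, X, U: the diagonal
    entries are 0, \<open>k1\<close>, \<open>k3\<close>. The next claim is the same for U.\<close>
  have 4: "(\<Sum>i\<in>I. x i / v i) = k1 + k3"
  proof -
    have "k1 + k3 = (\<Sum>i\<in>I. x i / v i - v i * x i)"
      unfolding k_defs sum.distrib[symmetric]
    proof (intro sum.cong refl)
      fix i assume i: "i \<in> I"
      have "x i ^ 3 / v i + x i * u i ^ 2 / v i = x i * (x i * x i + u i * u i) / v i"
        by (simp add: power2_eq_square power3_eq_cube add_divide_distrib algebra_simps)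
      also have "\<dots> = x i / v i - v i * x i" unfolding unit[OF i] using nz[OF i] by (simp add: field_simps)
      finally show "x i ^ 3 / v i + x i * u i ^ 2 / v i = x i / v i - v i * x i" .
    qed
    then show ?thesis by (simp add: sum_subtractf vx)
  qed
  have 5: "(\<Sum>i\<in>I. u i / v i) = k2 + k4"
  proof -
    have "k2 + k4 = (\<Sum>i\<in>I. u i / v i - v i * u i)"
      unfolding k_defs sum.distrib[symmetric]
    proof (intro sum.cong refl)
      fix i assume i: "i \<in> I"
      have "x i ^ 2 * u i / v i + u i ^ 3 / v i = u i * (x i * x i + u i * u i) / v i"
        by (simp add: power2_eq_square power3_eq_cube add_divide_distrib algebra_simps)
      also have "\<dots> = u i / v i - v i * u i" unfolding unit[OF i] using nz[OF i] by (simp add: field_simps)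
      finally show "x i ^ 2 * u i / v i + u i ^ 3 / v i = u i / v i - v i * u i" .
    qed
    then show ?thesis by (simp add: sum_subtractf vu)
  qed
  have 6: "k2\<^sup>2 + k3\<^sup>2 - k1 * k3 - k2 * k4 = 1"
  proof -
    \<comment> \<open>Compare X (X U) with (X X) U at a column where U can be cancelled.\<close>
    obtain i where i: "i \<in> I" "u i \<noteq> 0" using uu by (metis (no_types, lifting) mult_zero_left sum.neutral zero_neq_one)
    define X U where "X = x i / v i" and "U = u i / v i"
    have a: "X\<^sup>2 = 1 + k1 * X + k2 * U" "X * U = k2 * X + k3 * U" "U\<^sup>2 = 1 + k3 * X + k4 * U"
      using 1 2 3 i by (simp_all add: X_def U_def)
    have "X * (k2 * X + k3 * U) = (1 + k1 * X + k2 * U) * U"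
      using a(1,2) by (metis mult.assoc power2_eq_square)
    then have "k2 * X\<^sup>2 + k3 * (X * U) = U + k1 * (X * U) + k2 * U\<^sup>2"
      by (simp add: algebra_simps power2_eq_square)
    then have "(k2\<^sup>2 + k3\<^sup>2 - k1 * k3 - k2 * k4 - 1) * U = 0"
      unfolding a by (simp add: algebra_simps power2_eq_square)
    moreover have "U \<noteq> 0" using i nz by (simp add: U_def)
    ultimately show ?thesis by simp
  qed
  have 7: "r = \<alpha> * k1 + \<beta> * k2 \<and> e = \<alpha> * k2 + \<beta> * k3 \<and> t = \<alpha> * k3 + \<beta> * k4"
    if diag: "\<And>i j. i \<in> I \<Longrightarrow> j \<in> I \<Longrightarrow> i \<noteq> j \<Longrightarrow> qform \<alpha> \<beta> r t e i j = 0" for \<alpha> \<beta> r t e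
  proof -
    define l where "l i = qform \<alpha> \<beta> r t e i i" for i
    have l: "l i = (\<alpha> * x i + \<beta> * u i) / v i" "l i * x i = \<alpha> * v i + r * x i + e * u i"
      "l i * u i = \<beta> * v i + e * x i + t * u i" if "i \<in> I" for i
      using qform_eigen[OF diag that] nz[OF that] by (simp_all add: l_def field_simps)
    \<comment> \<open>The eigenvalue function is l = \<alpha> X + \<beta> U. Its moments against x
      x, x u, u u are computed twice: from the eigenvector equations, which give the matrix entries,
      and from this formula, which gives the structure constants.\<close>
    have sums: "(\<Sum>i\<in>I. l i * x i * x i) = r" "(\<Sum>i\<in>I. l i * x i * u i) = e" "(\<Sum>i\<in>I. l i * u i * u i) = t"
    proof -
      have "(\<Sum>i\<in>I. l i * x i * w i) = (\<Sum>i\<in>I. \<alpha> * (v i * w i) + r * (x i * w i) + e * (u i * w i))" for w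
        by (intro sum.cong refl) (simp add: l(2) algebra_simps)
      then have *: "(\<Sum>i\<in>I. l i * x i * w i) = \<alpha> * (\<Sum>i\<in>I. v i * w i) + r * (\<Sum>i\<in>I. x i * w i) + e * (\<Sum>i\<in>I. u i * w i)" for w
        by (simp only: sum.distrib sum_distrib_left[symmetric])
      show "(\<Sum>i\<in>I. l i * x i * x i) = r" "(\<Sum>i\<in>I. l i * x i * u i) = e"
        by (simp_all add: * row_products)
      have "(\<Sum>i\<in>I. l i * u i * u i) = (\<Sum>i\<in>I. \<beta> * (v i * u i) + e * (x i * u i) + t * (u i * u i))"
        by (intro sum.cong refl) (simp add: l(3) algebra_simps)
      then show "(\<Sum>i\<in>I. l i * u i * u i) = t"
        by (simp add: sum.distrib sum_distrib_left[symmetric] vu xu uu)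
    qed
    have "(\<Sum>i\<in>I. l i * x i * x i) = (\<Sum>i\<in>I. \<alpha> * (x i ^ 3 / v i) + \<beta> * (x i ^ 2 * u i / v i))"
      "(\<Sum>i\<in>I. l i * x i * u i) = (\<Sum>i\<in>I. \<alpha> * (x i ^ 2 * u i / v i) + \<beta> * (x i * u i ^ 2 / v i))"
      "(\<Sum>i\<in>I. l i * u i * u i) = (\<Sum>i\<in>I. \<alpha> * (x i * u i ^ 2 / v i) + \<beta> * (u i ^ 3 / v i))"
      by (intro sum.cong refl, simp add: l(1) nz field_simps power2_eq_square power3_eq_cube)+
    then show ?thesis
      by (simp add: sums k_defs sum.distrib sum_distrib_left)
  qed
  show thesis by (rule that[OF 1 2 3 4 5 6 7])
qed

section \<open>Rigidity: the linearized system has only the trivial solution\<close>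

text \<open>After division by \<open>v\<close> all conditions concern X = x/v and U = u/v.
  Associativity and \<open>cubic\<close> give two quadratic relations between the structure
  constants, \<open>diag\<close> leaves one scalar \<rho> free, and \<open>quartic\<close> says that
  \<rho> times a positive number vanishes.\<close>

lemma rigid_generic:
  assumes I: "I = {i, j, k}" "i \<noteq> j" "i \<noteq> k" "j \<noteq> k"
    and nz: "v i \<noteq> 0" "v j \<noteq> 0" "v k \<noteq> 0"
    and diag: "\<And>a b. a \<in> I \<Longrightarrow> b \<in> I \<Longrightarrow> a \<noteq> b \<Longrightarrow> qform (-\<xi>) (3 * \<mu>) (-\<nu>) (3 * \<nu>) e a b = 0"
    and cubic: "3 * (u i * u j * v k + u i * v j * u k + v i * u j * u k)
       = x i * x j * v k + x i * v j * x k + v i * x j * x k"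
    and quartic: "\<nu> * (v i * (x j * u k + x k * u j) + v j * (x i * u k + x k * u i) + v k * (x i * u j + x j * u i))
       + \<xi> * (v i * v j * u k + v i * v k * u j + v j * v k * u i)
       + \<mu> * (v i * v j * x k + v i * v k * x j + v j * v k * x i) = 0"
  shows "\<xi> = 0 \<and> \<mu> = 0 \<and> \<nu> = 0 \<and> e = 0"
proof -
  have nz': "v a \<noteq> 0" if "a \<in> I" for a using that nz I by auto
  define X U where "X a = x a / v a" and "U a = u a / v a" for a
  obtain k1 k2 k3 k4 where
    sq: "\<And>a. a \<in> I \<Longrightarrow> (X a)\<^sup>2 = 1 + k1 * X a + k2 * U a"
    and XU: "\<And>a. a \<in> I \<Longrightarrow> X a * U a = k2 * X a + k3 * U a"
    and s: "(\<Sum>a\<in>I. X a) = k1 + k3" and t: "(\<Sum>a\<in>I. U a) = k2 + k4"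
    and assoc: "k2\<^sup>2 + k3\<^sup>2 - k1 * k3 - k2 * k4 = 1"
    and lin: "\<And>\<alpha> \<beta> r t e. (\<And>i j. i \<in> I \<Longrightarrow> j \<in> I \<Longrightarrow> i \<noteq> j \<Longrightarrow> qform \<alpha> \<beta> r t e i j = 0) \<Longrightarrow>
       r = \<alpha> * k1 + \<beta> * k2 \<and> e = \<alpha> * k2 + \<beta> * k3 \<and> t = \<alpha> * k3 + \<beta> * k4"
    unfolding X_def U_def by (rule structure_constants[OF nz']) blast+
  define s where "s = k1 + k3"
  define t where "t = k2 + k4"
  have s': "X i + X j + X k = s" and t': "U i + U j + U k = t"
    using s t I by (simp_all add: s_def t_def algebra_simps)
  have prod: "X a * X b + U a * U b = -1" if "a \<in> I" "b \<in> I" "a \<noteq> b" for a b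
  proof -
    have "v a * v b + x a * x b + u a * u b = 0" using cols[OF that(1,2)] that(3) by simp
    then show ?thesis using nz'[OF that(1)] nz'[OF that(2)] by (simp add: X_def U_def field_simps)
  qed
  \<comment> \<open>\<open>cubic\<close> divided by the product of the three \<open>v\<close>
    entries. Together with orthogonality of the columns it determines the second elementary
    symmetric functions of X and of U.\<close>
  have "3 * (U i * U j + U i * U k + U j * U k) = X i * X j + X i * X k + X j * X k"
    using cubic nz by (simp add: X_def U_def field_simps)
  moreover have "X i * X j + U i * U j = -1" "X i * X k + U i * U k = -1" "X j * X k + U j * U k = -1"
    using prod I by auto
  ultimately have e2: "X i * X j + X i * X k + X j * X k = - 9 / 4"
    by (simp add: algebra_simps)
  have "(X i)\<^sup>2 + (X j)\<^sup>2 + (X k)\<^sup>2 = 3 + k1 * s + k2 * t"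
    using sq I by (simp add: s'[symmetric] t'[symmetric] algebra_simps)
  moreover have "s\<^sup>2 = (X i)\<^sup>2 + (X j)\<^sup>2 + (X k)\<^sup>2 + 2 * (X i * X j + X i * X k + X j * X k)"
    by (simp add: s'[symmetric] power2_eq_square algebra_simps)
  ultimately have ii: "k2 * t - k3 * s = 3 / 2"
    using e2 by (simp add: s_def power2_eq_square algebra_simps)
  \<comment> \<open>The sum of X(a) U(b) over ordered pairs of distinct columns: the product of the
    two traces minus the diagonal part. It is the coefficient of \<nu> in \<open>quartic\<close>
    divided by the \<open>v\<close> entries.\<close>
  define \<Omega> where "\<Omega> = s * t - k2 * s - k3 * t"
  have "X i * U i + X j * U j + X k * U k = k2 * s + k3 * t"
    using XU I by (simp add: s'[symmetric] t'[symmetric] algebra_simps)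
  then have \<Omega>: "X j * U k + X k * U j + (X i * U k + X k * U i) + (X i * U j + X j * U i) = \<Omega>"
    unfolding \<Omega>_def by (simp add: s'[symmetric] t'[symmetric] algebra_simps)
  have iii: "\<nu> * \<Omega> + \<xi> * t + \<mu> * s = 0"
  proof -
    have ratio: "x i = v i * X i" "x j = v j * X j" "x k = v k * X k"
      "u i = v i * U i" "u j = v j * U j" "u k = v k * U k"
      using nz by (simp_all add: X_def U_def)
    have "v i * v j * v k * (\<nu> * \<Omega> + \<xi> * t + \<mu> * s) = 0"
      using quartic unfolding \<Omega>[symmetric] s'[symmetric] t'[symmetric] ratio
      by (simp add: algebra_simps)
    then show ?thesis using nz by simp
  qed
  have l: "-\<nu> = - \<xi> * k1 + 3 * \<mu> * k2" "e = - \<xi> * k2 + 3 * \<mu> * k3" "3 * \<nu> = - \<xi> * k3 + 3 * \<mu> * k4"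
    using lin[OF diag] by auto
  \<comment> \<open>Eliminating \<nu> from the first and third equations of \<open>l\<close> leaves
    one linear relation between \<xi> and 3 \<mu>, with coefficients \<open>a\<close> and
    \<open>b\<close>. As these do not both vanish, the solutions form a line, parametrized by
    \<rho>.\<close>
  define a b where "a = 3 * k1 + k3" and "b = 3 * k2 + k4"
  have ab: "\<xi> * a = 3 * \<mu> * b" using l by (simp add: a_def b_def algebra_simps)
  have "a \<noteq> 0 \<or> b \<noteq> 0"
  proof (rule ccontr)
    assume "\<not> ?thesis"
    then have st: "s = 2 / 3 * k3" "t = - 2 * k2" by (simp_all add: a_def b_def s_def t_def)
    have "2 * k2\<^sup>2 + 2 / 3 * k3\<^sup>2 = - 3 / 2"
      using ii unfolding st by (simp add: power2_eq_square algebra_simps)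
    then show False using zero_le_power2[of k2] zero_le_power2[of k3] by linarith
  qed
  then obtain \<rho> where \<rho>: "\<xi> = - \<rho> * b" "3 * \<mu> = - \<rho> * a"
  proof
    assume "a \<noteq> 0"
    then show thesis using ab by (intro that[of "- 3 * \<mu> / a"]) (simp_all add: field_simps)
  next
    assume "b \<noteq> 0"
    then show thesis using ab by (intro that[of "- \<xi> / b"]) (simp_all add: field_simps)
  qed
  have "2 * \<nu> = - \<xi> * s + 3 * \<mu> * t" using l by (simp add: s_def t_def algebra_simps)
  then have \<nu>: "\<nu> = - \<rho> * \<Omega>"
    unfolding \<rho> \<Omega>_def a_def b_def s_def t_def by (simp add: algebra_simps)
  \<comment> \<open>The associativity relation reads k2 t + k3 s = 2 k2^2 + 2 k3^2 - 1. The excess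
    of the left side over 3 s^2 + 3 t^2 is 6 k2 t - 2 k3 s, which is four times \<open>ii\<close>
    plus twice this relation.\<close>
  have pos: "3 * b * t + a * s = 3 * s\<^sup>2 + 3 * t\<^sup>2 + 4 + 4 * k2\<^sup>2 + 4 * k3\<^sup>2"
    using ii assoc unfolding a_def b_def s_def t_def power2_eq_square by algebra
  have "3 * \<nu> * \<Omega> + 3 * \<xi> * t + 3 * \<mu> * s = 0" using iii by simp
  then have "\<rho> * (3 * \<Omega>\<^sup>2 + (3 * b * t + a * s)) = 0"
    unfolding \<rho> \<nu> by (simp add: power2_eq_square algebra_simps)
  moreover have "3 * \<Omega>\<^sup>2 + (3 * b * t + a * s) > 0"
    unfolding pos by (simp add: add_nonneg_pos add_pos_nonneg)
  ultimately have "\<rho> = 0" by simp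
  then show ?thesis using \<rho> \<nu> l by simp
qed

text \<open>Column i now lies in the (x, u)-plane, and the other two columns form an orthonormal
  basis of the plane orthogonal to it. The cases distinguish whether column i is a coordinate axis,
  since \<open>cubic\<close> gives information only if it is not.\<close>

lemma rigid_zero:
  assumes I: "I = {i, j, k}" "i \<noteq> j" "i \<noteq> k" "j \<noteq> k" and z: "v i = 0"
    and diag: "\<And>a b. a \<in> I \<Longrightarrow> b \<in> I \<Longrightarrow> a \<noteq> b \<Longrightarrow> qform (-\<xi>) (3 * \<mu>) (-\<nu>) (3 * \<nu>) e a b = 0"
    and cubic: "3 * (u i * u j * v k + u i * v j * u k + v i * u j * u k)
       = x i * x j * v k + x i * v j * x k + v i * x j * x k"
    and quartic: "\<nu> * (v i * (x j * u k + x k * u j) + v j * (x i * u k + x k * u i) + v k * (x i * u j + x j * u i))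
       + \<xi> * (v i * v j * u k + v i * v k * u j + v j * v k * u i)
       + \<mu> * (v i * v j * x k + v i * v k * x j + v j * v k * x i) = 0"
  shows "\<xi> = 0 \<and> \<mu> = 0 \<and> \<nu> = 0 \<and> e = 0"
proof -
  have c: "x i * x i + u i * u i = 1" "x i * x j + u i * u j = 0" "x i * x k + u i * u k = 0"
    "v j * v j + x j * x j + u j * u j = 1" "v k * v k + x k * x k + u k * u k = 1"
    "v j * v k + x j * x k + u j * u k = 0"
    using cols[of i i] cols[of i j] cols[of i k] cols[of j j] cols[of k k] cols[of j k] I z by auto
  have r: "v j * v j + v k * v k = 1" "v j * x j + v k * x k = 0" "v j * u j + v k * u k = 0"
    "x i * x i + x j * x j + x k * x k = 1" "u i * u i + u j * u j + u k * u k = 1"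
    using vv vx vu xx uu I z by auto
  define \<alpha> \<beta> where "\<alpha> = - \<xi>" and "\<beta> = 3 * \<mu>"
  have ij: "(\<alpha> * x i + \<beta> * u i) * v j - \<nu> * x i * x j + 3 * \<nu> * u i * u j + e * (x i * u j + u i * x j) = 0"
    and ik: "(\<alpha> * x i + \<beta> * u i) * v k - \<nu> * x i * x k + 3 * \<nu> * u i * u k + e * (x i * u k + u i * x k) = 0"
    and jk: "\<alpha> * (x j * v k + v j * x k) + \<beta> * (u j * v k + v j * u k) - \<nu> * x j * x k
      + 3 * \<nu> * u j * u k + e * (x j * u k + u j * x k) = 0"
    using diag[of i j] diag[of i k] diag[of j k] I z by (auto simp: qform_def \<alpha>_def \<beta>_def algebra_simps)
  have q: "\<nu> * (v j * (x i * u k + x k * u i) + v k * (x i * u j + x j * u i))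
     + \<xi> * (v j * v k * u i) + \<mu> * (v j * v k * x i) = 0"
    using quartic z by simp
  \<comment> \<open>In complex terms: (p + iq)(W + iZ) = 0 with nonzero second factor.\<close>
  have square_zero: "p = 0 \<and> q = 0"
    if "p * W = q * Z" "q * W = - (p * Z)" "W \<noteq> 0 \<or> Z \<noteq> 0" for p q W Z :: real
  proof -
    have "p * (W * W + Z * Z) = (p * W - q * Z) * W + (q * W + p * Z) * Z"
      "q * (W * W + Z * Z) = (q * W + p * Z) * W - (p * W - q * Z) * Z"
      by (simp_all add: algebra_simps)
    then have "p * (W * W + Z * Z) = 0" "q * (W * W + Z * Z) = 0" using that(1,2) by simp_all
    then show ?thesis using that(3) by (auto simp: sum_squares_eq_zero_iff)
  qed
  \<comment> \<open>The vector (p, q) is in the kernel of a matrix with orthonormal columns.\<close>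
  have orthonormal_solve: "p = 0 \<and> q = 0"
    if "p * a + q * b = 0" "p * a' + q * b' = 0" "a * a + a' * a' = 1" "b * b + b' * b' = 1" "a * b + a' * b' = 0"
    for p q a b a' b' :: real
  proof -
    have "p * (a * a + a' * a') + q * (a * b + a' * b') = a * (p * a + q * b) + a' * (p * a' + q * b')"
      "p * (a * b + a' * b') + q * (b * b + b' * b') = b * (p * a + q * b) + b' * (p * a' + q * b')"
      by (simp_all add: algebra_simps)
    then show ?thesis unfolding that by simp
  qed
  consider "u i = 0" | "x i = 0" | "x i \<noteq> 0" "u i \<noteq> 0" by blast
  then show ?thesis
  proof cases
    case 1
    then have xi: "x i \<noteq> 0" using c(1) by auto
    then have x0: "x j = 0" "x k = 0" using 1 c(2,3) by auto
    have "x i * (\<alpha> * v j + e * u j) = 0" "x i * (\<alpha> * v k + e * u k) = 0"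
      using ij ik by (simp_all add: 1 x0 algebra_simps)
    then have *: "\<alpha> * v j + e * u j = 0" "\<alpha> * v k + e * u k = 0" using xi by simp_all
    have "\<alpha> = 0" using orthonormal_solve[OF * r(1) _ r(3)] r(5) 1 by simp
    moreover have "e = 0" using orthonormal_solve[OF * r(1) _ r(3)] r(5) 1 by simp
    moreover have "\<mu> = 0 \<and> \<nu> = 0"
    proof (rule square_zero)
      show "\<mu> * (u j * v k + v j * u k) = \<nu> * (v j * v k)"
      proof -
        have "u j * u k = - (v j * v k)" using c(6) x0 by simp
        then show ?thesis using jk by (simp add: x0 \<beta>_def mult.assoc)
      qed
      have "x i * (\<nu> * (u j * v k + v j * u k) + \<mu> * (v j * v k)) = 0"
        using q by (simp add: 1 x0 algebra_simps)
      then show "\<nu> * (u j * v k + v j * u k) = - (\<mu> * (v j * v k))" using xi by simp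
      show "u j * v k + v j * u k \<noteq> 0 \<or> v j * v k \<noteq> 0"
        using r(1) c(4,5) x0 by auto
    qed
    ultimately show ?thesis by (simp add: \<alpha>_def)
  next
    case 2
    then have ui: "u i \<noteq> 0" using c(1) by auto
    then have u0: "u j = 0" "u k = 0" using 2 c(2,3) by auto
    have "u i * (\<beta> * v j + e * x j) = 0" "u i * (\<beta> * v k + e * x k) = 0"
      using ij ik by (simp_all add: 2 u0 algebra_simps)
    then have *: "\<beta> * v j + e * x j = 0" "\<beta> * v k + e * x k = 0" using ui by simp_all
    have "\<beta> = 0" using orthonormal_solve[OF * r(1) _ r(2)] r(4) 2 by simp
    moreover have "e = 0" using orthonormal_solve[OF * r(1) _ r(2)] r(4) 2 by simp
    moreover have "\<xi> = 0 \<and> \<nu> = 0"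
    proof (rule square_zero)
      show "\<xi> * (x j * v k + v j * x k) = \<nu> * (v j * v k)"
      proof -
        have "x j * x k = - (v j * v k)" using c(6) u0 by simp
        then show ?thesis using jk by (simp add: u0 \<alpha>_def mult.assoc)
      qed
      have "u i * (\<nu> * (x j * v k + v j * x k) + \<xi> * (v j * v k)) = 0"
        using q by (simp add: 2 u0 algebra_simps)
      then show "\<nu> * (x j * v k + v j * x k) = - (\<xi> * (v j * v k))" using ui by simp
      show "x j * v k + v j * x k \<noteq> 0 \<or> v j * v k \<noteq> 0"
        using r(1) c(4,5) u0 by auto
    qed
    ultimately show ?thesis by (simp add: \<beta>_def)
  next
    case 3
    \<comment> \<open>The coordinate of a column along n = (-u(i), x(i)) in the (x, u)-plane.
      Columns j and k have coordinates (v, \<rho>) in the orthonormal basis formed by the v axis and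
      n.\<close>
    define \<rho> where "\<rho> l = x i * u l - u i * x l" for l
    have \<rho>: "x j = - (u i * \<rho> j)" "u j = x i * \<rho> j" "x k = - (u i * \<rho> k)" "u k = x i * \<rho> k"
    proof -
      have "x j = (x i * x i + u i * u i) * x j - x i * (x i * x j + u i * u j)"
        "u j = (x i * x i + u i * u i) * u j - u i * (x i * x j + u i * u j)"
        "x k = (x i * x i + u i * u i) * x k - x i * (x i * x k + u i * u k)"
        "u k = (x i * x i + u i * u i) * u k - u i * (x i * x k + u i * u k)"
        unfolding c(1-3) by simp_all
      then show "x j = - (u i * \<rho> j)" "u j = x i * \<rho> j" "x k = - (u i * \<rho> k)" "u k = x i * \<rho> k"
        unfolding \<rho>_def by (simp_all add: algebra_simps)
    qed
    have \<rho>': "v j * v k + \<rho> j * \<rho> k = 0" "v j * v j + \<rho> j * \<rho> j = 1" "v k * v k + \<rho> k * \<rho> k = 1"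
    proof -
      have "x l * x m + u l * u m = (x i * x i + u i * u i) * (\<rho> l * \<rho> m)"
        if "l = j \<or> l = k" "m = j \<or> m = k" for l m
        using that by (elim disjE) (simp_all only: \<rho>, simp_all add: algebra_simps)
      from this[of j k] this[of j j] this[of k k] show "v j * v k + \<rho> j * \<rho> k = 0"
        "v j * v j + \<rho> j * \<rho> j = 1" "v k * v k + \<rho> k * \<rho> k = 1"
        using c(4-6) unfolding c(1) by simp_all
    qed
    have "x i * u i * (v j * \<rho> k + v k * \<rho> j) = 0"
      using cubic z unfolding \<rho> by (simp add: algebra_simps)
    then have d: "v j * \<rho> k + v k * \<rho> j = 0" using 3 by simp
    \<comment> \<open>The relation \<open>d\<close> puts the frame (v, \<rho>) at 45 degrees to the
      axes, so all four squares are 1/2.\<close>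
    have "(v j * \<rho> k) * (v j * \<rho> k) = (v k * \<rho> j) * (v k * \<rho> j)"
      using d by (simp add: eq_neg_iff_add_eq_0[symmetric])
    then have "v j * v j * (\<rho> k * \<rho> k) = v k * v k * (\<rho> j * \<rho> j)" by (simp add: mult_ac)
    moreover have "\<rho> k * \<rho> k = 1 - v k * v k" "\<rho> j * \<rho> j = 1 - v j * v j" using \<rho>' by simp_all
    ultimately have "v j * v j = v k * v k" by (simp add: algebra_simps)
    then have half: "2 * (v j * v j) = 1" "2 * (v k * v k) = 1" "2 * (\<rho> k * \<rho> k) = 1" "2 * (\<rho> j * \<rho> j) = 1"
      using \<rho>' r(1) by simp_all
    \<comment> \<open>The values of the bilinear form at column i paired with the v axis and with
      n.\<close>
    define G H where "G = \<alpha> * x i + \<beta> * u i" and "H = 4 * \<nu> * (x i * u i) + e * (x i * x i - u i * u i)"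
    have GH: "G * v j + H * \<rho> j = 0" "G * v k + H * \<rho> k = 0"
      using ij ik unfolding \<rho> G_def H_def by (simp_all add: algebra_simps)
    have "v j * \<rho> k \<noteq> 0" using half by auto
    moreover have "G * (2 * (v j * \<rho> k)) = 0" "H * (2 * (v j * \<rho> k)) = 0"
    proof -
      \<comment> \<open>Cramer's rule; by \<open>d\<close> the determinant v(j) \<rho>(k) - v(k)
        \<rho>(j) equals 2 v(j) \<rho>(k).\<close>
      have "G * (2 * (v j * \<rho> k)) = \<rho> k * (G * v j + H * \<rho> j) - \<rho> j * (G * v k + H * \<rho> k) + G * (v j * \<rho> k + v k * \<rho> j)"
        "H * (2 * (v j * \<rho> k)) = v j * (G * v k + H * \<rho> k) - v k * (G * v j + H * \<rho> j) + H * (v j * \<rho> k + v k * \<rho> j)"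
        by (simp_all add: algebra_simps)
      then show "G * (2 * (v j * \<rho> k)) = 0" "H * (2 * (v j * \<rho> k)) = 0" unfolding GH d by simp_all
    qed
    ultimately have GH0: "G = 0" "H = 0" by auto
    \<comment> \<open>The last factor is the value of the form at (n, n). The mixed terms between n
      and the v axis cancel by \<open>d\<close>.\<close>
    have "\<rho> j * \<rho> k * (3 * \<nu> * (x i * x i) - \<nu> * (u i * u i) - 2 * e * (x i * u i)) = 0"
    proof -
      have "\<alpha> * (x j * v k + v j * x k) + \<beta> * (u j * v k + v j * u k) - \<nu> * x j * x k
          + 3 * \<nu> * u j * u k + e * (x j * u k + u j * x k)
        = (\<beta> * x i - \<alpha> * u i) * (v j * \<rho> k + v k * \<rho> j)
          + \<rho> j * \<rho> k * (3 * \<nu> * (x i * x i) - \<nu> * (u i * u i) - 2 * e * (x i * u i))"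
        unfolding \<rho> by (simp add: algebra_simps)
      then show ?thesis using jk d by simp
    qed
    moreover have "\<rho> j * \<rho> k \<noteq> 0" using half by auto
    ultimately have F: "3 * \<nu> * (x i * x i) - \<nu> * (u i * u i) - 2 * e * (x i * u i) = 0" by simp
    \<comment> \<open>Eliminate \<open>e\<close> between \<open>F\<close> and \<open>H\<close>; the
      resulting coefficient of \<nu> is positive.\<close>
    have "\<nu> * (3 * x i ^ 4 + 4 * x i ^ 2 * u i ^ 2 + u i ^ 4) = 0"
    proof -
      have "\<nu> * (3 * x i ^ 4 + 4 * x i ^ 2 * u i ^ 2 + u i ^ 4)
        = (x i * x i - u i * u i) * (3 * \<nu> * (x i * x i) - \<nu> * (u i * u i) - 2 * e * (x i * u i))
          + 2 * (x i * u i) * H"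
        unfolding H_def by (simp add: power2_eq_square power4_eq_xxxx algebra_simps)
      then show ?thesis unfolding F GH0 by simp
    qed
    moreover have "3 * x i ^ 4 + 4 * x i ^ 2 * u i ^ 2 + u i ^ 4 > 0"
      using 3 by (simp add: add_pos_nonneg)
    ultimately have \<nu>: "\<nu> = 0" by simp
    then have e: "e = 0" using F 3 by simp
    have "v j * v k \<noteq> 0" using half r(1) by auto
    moreover have "v j * v k * (\<xi> * u i + \<mu> * x i) = 0" using q \<nu> by (simp add: algebra_simps)
    ultimately have "\<xi> * u i + \<mu> * x i = 0" by simp
    then have "\<mu> * (x i * x i + 3 * (u i * u i)) = 0"
    proof -
      have "\<mu> * (x i * x i + 3 * (u i * u i)) = x i * (\<xi> * u i + \<mu> * x i) + u i * G"
        unfolding G_def \<alpha>_def \<beta>_def by (simp add: algebra_simps)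
      then show ?thesis unfolding GH0 using \<open>\<xi> * u i + \<mu> * x i = 0\<close> by simp
    qed
    moreover have "x i * x i + 3 * (u i * u i) > 0"
      using 3 by (simp add: add_pos_nonneg flip: power2_eq_square)
    ultimately have \<mu>: "\<mu> = 0" by simp
    then have "\<xi> = 0" using GH0(1) 3 by (simp add: G_def \<alpha>_def \<beta>_def)
    then show ?thesis using \<mu> \<nu> e by simp
  qed
qed

text \<open>The hypotheses are symmetric in the three columns, so a column with \<open>v\<close>
  equal to 0 can be listed first.\<close>

lemma rigid:
  assumes I: "I = {i, j, k}" "i \<noteq> j" "i \<noteq> k" "j \<noteq> k"
    and diag: "\<And>a b. a \<in> I \<Longrightarrow> b \<in> I \<Longrightarrow> a \<noteq> b \<Longrightarrow> qform (-\<xi>) (3 * \<mu>) (-\<nu>) (3 * \<nu>) e a b = 0"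
    and cubic: "3 * (u i * u j * v k + u i * v j * u k + v i * u j * u k)
       = x i * x j * v k + x i * v j * x k + v i * x j * x k"
    and quartic: "\<nu> * (v i * (x j * u k + x k * u j) + v j * (x i * u k + x k * u i) + v k * (x i * u j + x j * u i))
       + \<xi> * (v i * v j * u k + v i * v k * u j + v j * v k * u i)
       + \<mu> * (v i * v j * x k + v i * v k * x j + v j * v k * x i) = 0"
  shows "\<xi> = 0 \<and> \<mu> = 0 \<and> \<nu> = 0 \<and> e = 0"
proof -
  consider "v i = 0" | "v j = 0" | "v k = 0" | "v i \<noteq> 0" "v j \<noteq> 0" "v k \<noteq> 0" by blast
  then show ?thesis
  proof cases
    case 1
    show ?thesis by (rule rigid_zero[OF I 1 diag cubic quartic])
  next
    case 2
    show ?thesis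
    proof (rule rigid_zero[of j i k])
      show "I = {j, i, k}" using I by auto
    qed (use 2 I diag cubic quartic in \<open>auto simp: algebra_simps\<close>)
  next
    case 3
    show ?thesis
    proof (rule rigid_zero[of k i j])
      show "I = {k, i, j}" using I by auto
    qed (use 3 I diag cubic quartic in \<open>auto simp: algebra_simps\<close>)
  next
    case 4
    show ?thesis by (rule rigid_generic[OF I 4 diag cubic quartic])
  qed
qed

end

section \<open>Zeros for parameter 0 have a column along the y axis\<close>

lemma index_complement_of_pair:
  fixes i j :: 4
  assumes "i \<noteq> j"
  obtains k l where "distinct [i, j, k, l]" "UNIV = {i, j, k, l}"
proof -
  have "card (UNIV - {i, j}) = 2" using assms by (simp add: card_Diff_subset)
  then obtain k l where "UNIV - {i, j} = {k, l}" "k \<noteq> l" by (auto simp: card_2_iff)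
  then show thesis using assms by (intro that[of k l]) auto
qed

lemma index_complement:
  fixes i :: 4
  obtains j k l where "distinct [i, j, k, l]" "UNIV = {i, j, k, l}"
proof -
  obtain j where "i \<noteq> j" by (metis exhaust_4 one_neq_zero add_left_cancel add_0_right)
  then show thesis using index_complement_of_pair that by metis
qed

text \<open>Here \<open>q\<close> is the polar form of 3 u^2 - x^2. First some \<open>v\<close>
  entry vanishes; then the cases are split by the number of vanishing \<open>v\<close> entries.
  Columns on which \<open>q\<close> is diagonal are eigenvectors of this form, which leaves only the
  axis directions of x and u to be excluded.\<close>

lemma vertical_column_exists:
  fixes v x y u :: "4 \<Rightarrow> real"
  defines "q \<equiv> \<lambda>i j. 3 * u i * u j - x i * x j"
  assumes cols: "\<And>i j. v i * v j + x i * x j + y i * y j + u i * u j = (if i = j then 1 else 0)"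
    and rows: "(\<Sum>i\<in>UNIV. v i * v i) = 1" "(\<Sum>i\<in>UNIV. x i * x i) = 1" "(\<Sum>i\<in>UNIV. u i * u i) = 1"
      "(\<Sum>i\<in>UNIV. v i * x i) = 0" "(\<Sum>i\<in>UNIV. v i * u i) = 0" "(\<Sum>i\<in>UNIV. x i * u i) = 0"
    and tri: "\<And>i j k. distinct [i, j, k] \<Longrightarrow> q i j * v k + q i k * v j + q j k * v i = 0"
    and quart: "\<And>i j k l. distinct [i, j, k, l] \<Longrightarrow>
       v i * v j * (x k * u l + x l * u k) + v i * v k * (x j * u l + x l * u j) + v i * v l * (x j * u k + x k * u j)
       + v j * v k * (x i * u l + x l * u i) + v j * v l * (x i * u k + x k * u i) + v k * v l * (x i * u j + x j * u i) = 0"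
  obtains i where "x i = 0" "u i = 0" "v i = 0"
proof -
  have sym: "q i j = q j i" for i j by (simp add: q_def)
  \<comment> \<open>The row \<open>v\<close> is orthogonal to the rows \<open>x\<close> and
    \<open>u\<close>, so it lies in the kernel of the matrix of \<open>q\<close> on the
    columns.\<close>
  have qv: "(\<Sum>j\<in>UNIV. q i j * v j) = 0" for i
  proof -
    have "(\<Sum>j\<in>UNIV. q i j * v j) = 3 * u i * (\<Sum>j\<in>UNIV. v j * u j) - x i * (\<Sum>j\<in>UNIV. v j * x j)"
      by (simp add: q_def sum_distrib_left sum_subtractf algebra_simps)
    then show ?thesis by (simp add: rows)
  qed
  have sq_le: "x i * x i + u i * u i \<le> 1" for i
    using cols[of i i, simplified] zero_le_square[of "v i"] zero_le_square[of "y i"] by linarith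
  have "\<exists>i. v i = 0"
  proof -
    obtain i j k l :: 4 where d: "distinct [i, j, k, l]" and U: "UNIV = {i, j, k, l}"
      by (rule index_complement)
    have "v i * v j * v k * v l * 2 = 0"
    proof -
      have tr: "q i i + q j j + q k k + q l l = 2"
        using rows(2,3) d by (simp add: U q_def)
      have s: "v i * v i + v j * v j + v k * v k + v l * v l = 1" using rows(1) d by (simp add: U)
      have r: "q i i * v i + q i j * v j + q i k * v k + q i l * v l = 0"
        "q i j * v i + q j j * v j + q j k * v k + q j l * v l = 0"
        "q i k * v i + q j k * v j + q k k * v k + q k l * v l = 0"
        "q i l * v i + q j l * v j + q k l * v k + q l l * v l = 0"
        using qv[of i] qv[of j] qv[of k] qv[of l] d
        by (simp_all add: U sym[of j i] sym[of k i] sym[of k j] sym[of l i] sym[of l j] sym[of l k])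
      have t: "q i j * v k + q i k * v j + q j k * v i = 0" "q i j * v l + q i l * v j + q j l * v i = 0"
        "q i k * v l + q i l * v k + q k l * v i = 0" "q j k * v l + q j l * v k + q k l * v j = 0"
        using d by (auto intro!: tri)
      \<comment> \<open>the equations \<open>t\<close>, weighted once by \<open>v\<close> and once by \<open>v\<^sup>3\<close>, leave the trace of \<open>q\<close>\<close>
      have "v i * v j * v k * v l * (q i i + q j j + q k k + q l l) =
          v j * v k * v l * (q i i * v i + q i j * v j + q i k * v k + q i l * v l)
        + v i * v k * v l * (q i j * v i + q j j * v j + q j k * v k + q j l * v l)
        + v i * v j * v l * (q i k * v i + q j k * v j + q k k * v k + q k l * v l)
        + v i * v j * v k * (q i l * v i + q j l * v j + q k l * v k + q l l * v l)
        - (v i * v i + v j * v j + v k * v k + v l * v l) / 2 *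
          (v l * (q i j * v k + q i k * v j + q j k * v i) + v k * (q i j * v l + q i l * v j + q j l * v i)
            + v j * (q i k * v l + q i l * v k + q k l * v i) + v i * (q j k * v l + q j l * v k + q k l * v j))
        + (v l ^ 3 * (q i j * v k + q i k * v j + q j k * v i) + v k ^ 3 * (q i j * v l + q i l * v j + q j l * v i)
            + v j ^ 3 * (q i k * v l + q i l * v k + q k l * v i) + v i ^ 3 * (q j k * v l + q j l * v k + q k l * v j))"
        by (simp add: power3_eq_cube field_simps)
      then show ?thesis unfolding tr r t by simp
    qed
    then show ?thesis by auto
  qed
  then obtain i where vi: "v i = 0" by blast
  \<comment> \<open>Column a is then an eigenvector of the diagonal form with eigenvalues -1 on x, 3
    on u and 0 on y and v, so it lies in the (y, v)-plane or on the u axis or on the x axis.\<close>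
  have eigen: "x a = 0 \<and> u a = 0 \<or> u a * u a = 1 \<and> x a = 0 \<or> x a * x a = 1 \<and> u a = 0"
    if q0: "\<And>b. b \<noteq> a \<Longrightarrow> q a b = 0" for a
  proof -
    have "(\<Sum>b\<in>UNIV. q a b * w b) = q a a * w a" for w
    proof -
      have "(\<Sum>b\<in>UNIV. q a b * w b) = (\<Sum>b\<in>UNIV. if b = a then q a a * w a else 0)"
        using q0 by (intro sum.cong) auto
      then show ?thesis by simp
    qed
    moreover have "(\<Sum>b\<in>UNIV. q a b * w b) = 3 * u a * (\<Sum>b\<in>UNIV. u b * w b) - x a * (\<Sum>b\<in>UNIV. x b * w b)" for w
      by (simp add: q_def sum_distrib_left sum_subtractf algebra_simps)
    ultimately have e: "q a a * w a = 3 * u a * (\<Sum>b\<in>UNIV. u b * w b) - x a * (\<Sum>b\<in>UNIV. x b * w b)" for w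
      by metis
    have "q a a * u a = 3 * u a" using e[of u] rows by simp
    moreover have "q a a * x a = - x a" using e[of x] rows by (simp add: mult.commute[of "u a" "x a" for a])
    ultimately consider "x a = 0" "u a = 0" | "q a a = 3" | "q a a = -1"
      by (metis mult_cancel_right mult_minus1)
    then show ?thesis
    proof cases
      case 2
      then have "3 * (u a * u a) = 3 + x a * x a" by (simp add: q_def)
      then have "u a * u a = 1" "x a * x a = 0" using sq_le[of a] zero_le_square[of "x a"] by linarith+
      then show ?thesis by simp
    next
      case 3
      then have "x a * x a = 1 + 3 * (u a * u a)" by (simp add: q_def)
      then have "x a * x a = 1" "u a * u a = 0" using sq_le[of a] zero_le_square[of "u a"] by linarith+
      then show ?thesis by simp
    qed simp
  qed
  show thesis
  proof (cases "\<exists>j. j \<noteq> i \<and> v j = 0")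
    case True
    then obtain j where ij: "i \<noteq> j" and vj: "v j = 0" by metis
    obtain k l where d: "distinct [i, j, k, l]" and U: "UNIV = {i, j, k, l}" using index_complement_of_pair[OF ij] .
    show thesis
    proof (cases "v k = 0 \<or> v l = 0")
      case False
      have "q i j = 0" using tri[of i j k] d vi vj False by simp
      then have 1: "3 * (u i * u j) = x i * x j" by (simp add: q_def)
      have 2: "x i * u j + x j * u i = 0" using quart[OF d] vi vj False by simp
      \<comment> \<open>\<open>1\<close> and \<open>2\<close> form a linear system for (x(j), u(j)),
        whose determinant is 3 u(i)^2 + x(i)^2 up to sign; so column i or column j is
        vertical.\<close>
      have "x j * (3 * (u i * u i) + x i * x i) = 3 * u i * (x i * u j + x j * u i) - x i * (3 * (u i * u j) - x i * x j)"
        "u j * (3 * (u i * u i) + x i * x i) = u i * (3 * (u i * u j) - x i * x j) + x i * (x i * u j + x j * u i)"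
        by (simp_all add: algebra_simps)
      then have "x j * (3 * (u i * u i) + x i * x i) = 0" "u j * (3 * (u i * u i) + x i * x i) = 0"
        by (simp_all add: 1 2)
      moreover have "3 * (u i * u i) + x i * x i = 0 \<longleftrightarrow> u i = 0 \<and> x i = 0"
        by (auto simp: add_nonneg_eq_0_iff)
      ultimately show thesis using that vi vj by auto
    next
      case True
      then obtain k' l' where d': "distinct [i, j, k', l']" and U': "UNIV = {i, j, k', l'}" and vk: "v k' = 0"
      proof
        assume "v k = 0" then show thesis using that[of k l] d U by blast
      next
        assume "v l = 0" then show thesis using that[of l k] d U by auto
      qed
      \<comment> \<open>With three vanishing entries, column l' lies on the v axis and
        \<open>tri\<close> makes \<open>q\<close> diagonal on the other three columns. Each of these
        is vertical or on the x or u axis, and the rows \<open>x\<close> and \<open>u\<close> have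
        total square sum 2, so one of the three is vertical.\<close>
      have vl: "v l' * v l' = 1" using rows(1) d' vi vj vk by (simp add: U')
      have "v l' \<noteq> 0" using vl by auto
      have l0: "x l' = 0" "u l' = 0"
        using cols[of l' l'] vl zero_le_square[of "x l'"] zero_le_square[of "y l'"] zero_le_square[of "u l'"]
        by (simp_all add: add_nonneg_eq_0_iff)
      have q0: "q i j = 0" "q i k' = 0" "q j k' = 0" "q i l' = 0" "q j l' = 0" "q k' l' = 0"
        using tri[of i j l'] tri[of i k' l'] tri[of j k' l'] d' vi vj vk \<open>v l' \<noteq> 0\<close>
        by (simp_all add: l0 q_def)
      have "x i = 0 \<and> u i = 0 \<or> u i * u i = 1 \<or> x i * x i = 1"
        "x j = 0 \<and> u j = 0 \<or> u j * u j = 1 \<or> x j * x j = 1"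
        "x k' = 0 \<and> u k' = 0 \<or> u k' * u k' = 1 \<or> x k' * x k' = 1"
      proof -
        have "q i b = 0" if "b \<noteq> i" for b using that q0 sym U' by (metis UNIV_I empty_iff insert_iff)
        then show "x i = 0 \<and> u i = 0 \<or> u i * u i = 1 \<or> x i * x i = 1" using eigen by blast
        have "q j b = 0" if "b \<noteq> j" for b using that q0 sym U' by (metis UNIV_I empty_iff insert_iff)
        then show "x j = 0 \<and> u j = 0 \<or> u j * u j = 1 \<or> x j * x j = 1" using eigen by blast
        have "q k' b = 0" if "b \<noteq> k'" for b using that q0 sym U' by (metis UNIV_I empty_iff insert_iff)
        then show "x k' = 0 \<and> u k' = 0 \<or> u k' * u k' = 1 \<or> x k' * x k' = 1" using eigen by blast
      qed
      moreover have "u i * u i + u j * u j + u k' * u k' = 1" "x i * x i + x j * x j + x k' * x k' = 1"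
        using rows(2,3) d' l0 by (simp_all add: U')
      ultimately have "x i = 0 \<and> u i = 0 \<or> x j = 0 \<and> u j = 0 \<or> x k' = 0 \<and> u k' = 0"
        using zero_le_square[of "u i"] zero_le_square[of "u j"] zero_le_square[of "u k'"]
          zero_le_square[of "x i"] zero_le_square[of "x j"] zero_le_square[of "x k'"]
        by linarith
      then show thesis using that vi vj vk by blast
    qed
  next
    case False
    obtain j k l where d: "distinct [i, j, k, l]" and U: "UNIV = {i, j, k, l}" by (rule index_complement)
    have nz: "v j \<noteq> 0" "v k \<noteq> 0" "v l \<noteq> 0" using False d by auto
    have t: "q i j * v k + q i k * v j = 0" "q i j * v l + q i l * v j = 0" "q i k * v l + q i l * v k = 0"
      using tri[of i j k] tri[of i j l] tri[of i k l] d vi by simp_all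
    have "q i j * (2 * v k * v l) = v l * (q i j * v k + q i k * v j) + v k * (q i j * v l + q i l * v j) - v j * (q i k * v l + q i l * v k)"
      by (simp add: algebra_simps)
    then have "q i j = 0" using t nz by simp
    moreover then have "q i k = 0" "q i l = 0" using t nz by simp_all
    ultimately have q0: "q i b = 0" if "b \<noteq> i" for b using that U by (metis UNIV_I empty_iff insert_iff)
    \<comment> \<open>For W = w/v the first two elementary symmetric functions vanish, hence so does
      the sum of squares. If column i were on the u axis or the x axis, \<open>quart\<close> and
      \<open>tri\<close> would yield this situation for w = x or w = u respectively.\<close>
    have no_isotropic: False
      if w: "w j / v j + w k / v k + w l / v l = 0"
        "w j * w k * v l + w j * w l * v k + w k * w l * v j = 0" "w j * w j + w k * w k + w l * w l = 1" for w :: "4 \<Rightarrow> real"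
    proof -
      define W where "W a = w a / v a" for a
      have "W j * W k + W j * W l + W k * W l = 0" using w(2) nz by (simp add: W_def field_simps)
      then have "W j * W j + W k * W k + W l * W l = (W j + W k + W l) * (W j + W k + W l)"
        by (simp add: algebra_simps)
      also have "\<dots> = 0" using w(1) by (simp add: W_def)
      finally have "W j = 0" "W k = 0" "W l = 0" by (simp_all add: add_nonneg_eq_0_iff)
      then show False using w(3) nz by (simp add: W_def)
    qed
    have "\<not> (u i * u i = 1 \<and> x i = 0)"
    proof
      assume ui: "u i * u i = 1 \<and> x i = 0"
      then have "u i \<noteq> 0" by auto
      have u0: "u j = 0" "u k = 0" "u l = 0"
        using rows(3) ui d by (simp_all add: U add_nonneg_eq_0_iff)
      have "u i * (v j * v k * x l + v j * v l * x k + v k * v l * x j) = 0"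
        using quart[OF d] ui by (simp add: vi u0 algebra_simps)
      then have "v j * v k * x l + v j * v l * x k + v k * v l * x j = 0"
        using \<open>u i \<noteq> 0\<close> by (metis mult_eq_0_iff)
      then have "x j / v j + x k / v k + x l / v l = 0" using nz by (simp add: field_simps)
      moreover have "x j * x k * v l + x j * x l * v k + x k * x l * v j = 0"
        using tri[of j k l] d by (simp add: q_def u0)
      moreover have "x j * x j + x k * x k + x l * x l = 1" using rows(2) d ui by (simp add: U)
      ultimately show False by (rule no_isotropic)
    qed
    moreover have "\<not> (x i * x i = 1 \<and> u i = 0)"
    proof
      assume xi: "x i * x i = 1 \<and> u i = 0"
      then have "x i \<noteq> 0" by auto
      have x0: "x j = 0" "x k = 0" "x l = 0"
        using rows(2) xi d by (simp_all add: U add_nonneg_eq_0_iff)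
      have "x i * (v j * v k * u l + v j * v l * u k + v k * v l * u j) = 0"
        using quart[OF d] xi by (simp add: vi x0 algebra_simps)
      then have "v j * v k * u l + v j * v l * u k + v k * v l * u j = 0"
        using \<open>x i \<noteq> 0\<close> by (metis mult_eq_0_iff)
      then have "u j / v j + u k / v k + u l / v l = 0" using nz by (simp add: field_simps)
      moreover have "u j * u k * v l + u j * u l * v k + u k * u l * v j = 0"
        using tri[of j k l] d by (simp add: q_def x0)
      moreover have "u j * u j + u k * u k + u l * u l = 1" using rows(3) d xi by (simp add: U)
      ultimately show False by (rule no_isotropic)
    qed
    ultimately show thesis using eigen[OF q0] that vi by blast
  qed
qed

section \<open>The two symmetric forms\<close>

text \<open>Coordinates 1, 2, 3, 4 are x, y, u, v. On the diagonal the value is 3 (v (3 u^2 - x^2) +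
  2 e x y u), and that of \<open>quartic_form\<close> is 12 v^2 x u.\<close>

definition cubic_form :: "real \<Rightarrow> real^4 \<Rightarrow> real^4 \<Rightarrow> real^4 \<Rightarrow> real" where
  "cubic_form e p q r =
     3 * (p$3 * q$3 * r$4 + p$3 * q$4 * r$3 + p$4 * q$3 * r$3)
     - (p$1 * q$1 * r$4 + p$1 * q$4 * r$1 + p$4 * q$1 * r$1)
     + e * (p$1 * (q$2 * r$3 + q$3 * r$2) + p$2 * (q$1 * r$3 + q$3 * r$1) + p$3 * (q$1 * r$2 + q$2 * r$1))"

definition quartic_form :: "real^4 \<Rightarrow> real^4 \<Rightarrow> real^4 \<Rightarrow> real^4 \<Rightarrow> real" where
  "quartic_form p q r s =
     p$4 * q$4 * (r$1 * s$3 + s$1 * r$3) + p$4 * r$4 * (q$1 * s$3 + s$1 * q$3)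
     + p$4 * s$4 * (q$1 * r$3 + r$1 * q$3) + q$4 * r$4 * (p$1 * s$3 + s$1 * p$3)
     + q$4 * s$4 * (p$1 * r$3 + r$1 * p$3) + r$4 * s$4 * (p$1 * q$3 + q$1 * p$3)"

lemma cubic_form_permute:
  fixes \<pi> :: "3 \<Rightarrow> 3"
  assumes "\<pi> permutes UNIV"
  shows "cubic_form e (f (\<pi> 1)) (f (\<pi> 2)) (f (\<pi> 3)) = cubic_form e (f 1) (f 2) (f 3)"
proof -
  have "inj \<pi>" using assms by (rule permutes_inj)
  then have "\<pi> 1 \<noteq> \<pi> 2" "\<pi> 1 \<noteq> \<pi> 3" "\<pi> 2 \<noteq> \<pi> 3" by (simp_all add: inj_eq)
  then show ?thesis
    using exhaust_3[of "\<pi> 1"] exhaust_3[of "\<pi> 2"] exhaust_3[of "\<pi> 3"]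
    by (elim disjE) (simp_all add: cubic_form_def algebra_simps)
qed

lemma quartic_form_permute:
  fixes \<pi> :: "4 \<Rightarrow> 4"
  assumes "\<pi> permutes UNIV"
  shows "quartic_form (f (\<pi> 1)) (f (\<pi> 2)) (f (\<pi> 3)) (f (\<pi> 4)) = quartic_form (f 1) (f 2) (f 3) (f 4)"
proof -
  have "inj \<pi>" using assms by (rule permutes_inj)
  then have "\<pi> 1 \<noteq> \<pi> 2" "\<pi> 1 \<noteq> \<pi> 3" "\<pi> 1 \<noteq> \<pi> 4" "\<pi> 2 \<noteq> \<pi> 3" "\<pi> 2 \<noteq> \<pi> 4" "\<pi> 3 \<noteq> \<pi> 4"
    by (simp_all add: inj_eq)
  then show ?thesis
    using exhaust_4[of "\<pi> 1"] exhaust_4[of "\<pi> 2"] exhaust_4[of "\<pi> 3"] exhaust_4[of "\<pi> 4"]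
    by (elim disjE) (simp_all add: quartic_form_def algebra_simps)
qed

lemma cubic_form_in_sym_forms: "(\<lambda>X. cubic_form e (X $ 1) (X $ 2) (X $ 3)) \<in> (sym_forms :: ((real^4)^3 \<Rightarrow> real) set)"
proof -
  have "linear (\<lambda>v. cubic_form e ((\<chi> j. if j = i then v else X $ j) $ 1)
      ((\<chi> j. if j = i then v else X $ j) $ 2) ((\<chi> j. if j = i then v else X $ j) $ 3))" for X :: "(real^4)^3" and i
    using exhaust_3[of i] by (elim disjE) (auto intro!: linearI simp: cubic_form_def algebra_simps)
  moreover have "cubic_form e ((\<chi> j. X $ \<pi> j) $ 1) ((\<chi> j. X $ \<pi> j) $ 2) ((\<chi> j. X $ \<pi> j) $ 3) =
      cubic_form e (X $ 1) (X $ 2) (X $ 3)" if "\<pi> permutes UNIV" for X :: "(real^4)^3" and \<pi>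
    using cubic_form_permute[OF that, of e "($) X"] by simp
  ultimately show ?thesis unfolding sym_forms_def by simp
qed

lemma quartic_form_in_sym_forms:
  "(\<lambda>X. quartic_form (X $ 1) (X $ 2) (X $ 3) (X $ 4)) \<in> (sym_forms :: ((real^4)^4 \<Rightarrow> real) set)"
proof -
  have "linear (\<lambda>v. quartic_form ((\<chi> j. if j = i then v else X $ j) $ 1)
      ((\<chi> j. if j = i then v else X $ j) $ 2) ((\<chi> j. if j = i then v else X $ j) $ 3)
      ((\<chi> j. if j = i then v else X $ j) $ 4))" for X :: "(real^4)^4" and i
    using exhaust_4[of i] by (elim disjE) (auto intro!: linearI simp: quartic_form_def algebra_simps)
  moreover have "quartic_form ((\<chi> j. X $ \<pi> j) $ 1) ((\<chi> j. X $ \<pi> j) $ 2) ((\<chi> j. X $ \<pi> j) $ 3) ((\<chi> j. X $ \<pi> j) $ 4) =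
      quartic_form (X $ 1) (X $ 2) (X $ 3) (X $ 4)" if "\<pi> permutes UNIV" for X :: "(real^4)^4" and \<pi>
    using quartic_form_permute[OF that, of "($) X"] by simp
  ultimately show ?thesis unfolding sym_forms_def by simp
qed

section \<open>Common zeros on the orthogonal group and their limits\<close>

text \<open>Quantifying over all tuples of distinct columns makes the condition invariant under
  relabelling of columns, so later arguments can single out any column.\<close>

definition common_zero :: "real \<Rightarrow> real^4^4 \<Rightarrow> bool" where
  "common_zero e Q \<longleftrightarrow>
     (\<forall>i j k. distinct [i, j, k] \<longrightarrow> cubic_form e (column i Q) (column j Q) (column k Q) = 0) \<and>
     (\<forall>i j k l. distinct [i, j, k, l] \<longrightarrow> quartic_form (column i Q) (column j Q) (column k Q) (column l Q) = 0)"

lemma common_zeroI: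
  assumes "form_map (\<lambda>X. cubic_form e (X $ 1) (X $ 2) (X $ 3))
    (\<lambda>X. quartic_form (X $ 1) (X $ 2) (X $ 3) (X $ 4)) Q = 0"
  shows "common_zero e Q"
proof -
  \<comment> \<open>In the index type, \<open>0\<close> is the residue written \<open>4\<close> by
    \<open>exhaust_4\<close>.\<close>
  have four: "(0::4) = 4" by simp
  then have z: "cubic_form e (column 1 Q) (column 2 Q) (column 3 Q) = 0"
    "cubic_form e (column 4 Q) (column 2 Q) (column 3 Q) = 0"
    "cubic_form e (column 4 Q) (column 1 Q) (column 3 Q) = 0"
    "cubic_form e (column 4 Q) (column 1 Q) (column 2 Q) = 0"
    "quartic_form (column 4 Q) (column 1 Q) (column 2 Q) (column 3 Q) = 0"
    using assms unfolding form_map_eq_0_iff four by (simp_all add: vector_3 vector_4)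
  have "cubic_form e (column i Q) (column j Q) (column k Q) = 0" if "distinct [i, j, k]" for i j k
    using exhaust_4[of i] exhaust_4[of j] exhaust_4[of k] that
    by (elim disjE) (use z in \<open>auto simp: cubic_form_def algebra_simps\<close>)
  moreover have "quartic_form (column i Q) (column j Q) (column k Q) (column l Q) = 0"
    if "distinct [i, j, k, l]" for i j k l
    using exhaust_4[of i] exhaust_4[of j] exhaust_4[of k] exhaust_4[of l] that
    by (elim disjE) (use z in \<open>auto simp: quartic_form_def algebra_simps\<close>)
  ultimately show ?thesis by (simp add: common_zero_def)
qed

lemma orthogonal_matrix_entries:
  fixes Q :: "real^'n^'n"
  assumes "orthogonal_matrix Q"
  shows "(\<Sum>k\<in>UNIV. Q $ k $ i * Q $ k $ j) = (if i = j then 1 else 0)"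
    and "(\<Sum>k\<in>UNIV. Q $ i $ k * Q $ j $ k) = (if i = j then 1 else 0)"
proof -
  have "(transpose Q ** Q) $ i $ j = mat 1 $ i $ j" "(Q ** transpose Q) $ i $ j = mat 1 $ i $ j"
    using assms by (simp_all add: orthogonal_matrix_def)
  then show "(\<Sum>k\<in>UNIV. Q $ k $ i * Q $ k $ j) = (if i = j then 1 else 0)"
    "(\<Sum>k\<in>UNIV. Q $ i $ k * Q $ j $ k) = (if i = j then 1 else 0)"
    by (simp_all add: matrix_matrix_mult_def transpose_def mat_def)
qed

lemma bounded_orthogonal_matrices: "bounded {Q :: real^'n^'n. orthogonal_matrix Q}"
proof -
  have "norm Q \<le> real CARD('n)" if "orthogonal_matrix Q" for Q :: "real^'n^'n"
  proof -
    have "norm (Q $ i) = 1" for i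
      using orthogonal_matrix_entries(2)[OF that, of i i] by (simp add: norm_eq_1 inner_vec_def)
    moreover have "norm Q \<le> (\<Sum>i\<in>UNIV. norm (Q $ i))"
      unfolding norm_vec_def by (rule L2_set_le_sum) simp
    ultimately show ?thesis by simp
  qed
  then show ?thesis unfolding bounded_iff by blast
qed

lemma closed_orthogonal_matrix:
  fixes Q :: "nat \<Rightarrow> real^'n^'n"
  assumes "\<And>n. orthogonal_matrix (Q n)" "Q \<longlonglongrightarrow> L"
  shows "orthogonal_matrix L"
proof -
  have "(\<Sum>k\<in>UNIV. L $ k $ i * L $ k $ j) = (if i = j then 1 else 0)" for i j
  proof (rule LIMSEQ_unique)
    show "(\<lambda>n. \<Sum>k\<in>UNIV. Q n $ k $ i * Q n $ k $ j) \<longlonglongrightarrow> (\<Sum>k\<in>UNIV. L $ k $ i * L $ k $ j)"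
      by (intro tendsto_intros assms(2))
    show "(\<lambda>n. \<Sum>k\<in>UNIV. Q n $ k $ i * Q n $ k $ j) \<longlonglongrightarrow> (if i = j then 1 else 0)"
      by (simp add: orthogonal_matrix_entries(1)[OF assms(1)])
  qed
  then have "transpose L ** L = mat 1"
    by (simp add: vec_eq_iff matrix_matrix_mult_def transpose_def mat_def)
  then show ?thesis by (simp add: orthogonal_matrix)
qed

lemma common_zero_limit:
  assumes "\<And>n. common_zero (e n) (Q n)" "e \<longlonglongrightarrow> e'" "Q \<longlonglongrightarrow> L"
  shows "common_zero e' L"
proof -
  have "cubic_form e' (column i L) (column j L) (column k L) = 0" if "distinct [i, j, k]" for i j k
  proof (rule LIMSEQ_unique)
    show "(\<lambda>n. cubic_form (e n) (column i (Q n)) (column j (Q n)) (column k (Q n)))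
        \<longlonglongrightarrow> cubic_form e' (column i L) (column j L) (column k L)"
      unfolding cubic_form_def column_def by (simp, intro tendsto_intros assms(2,3))
    show "(\<lambda>n. cubic_form (e n) (column i (Q n)) (column j (Q n)) (column k (Q n))) \<longlonglongrightarrow> 0"
      using assms(1) that by (simp add: common_zero_def)
  qed
  moreover have "quartic_form (column i L) (column j L) (column k L) (column l L) = 0"
    if "distinct [i, j, k, l]" for i j k l
  proof (rule LIMSEQ_unique)
    show "(\<lambda>n. quartic_form (column i (Q n)) (column j (Q n)) (column k (Q n)) (column l (Q n)))
        \<longlonglongrightarrow> quartic_form (column i L) (column j L) (column k L) (column l L)"
      unfolding quartic_form_def column_def by (simp, intro tendsto_intros assms(3))
    show "(\<lambda>n. quartic_form (column i (Q n)) (column j (Q n)) (column k (Q n)) (column l (Q n))) \<longlonglongrightarrow> 0"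
      using assms(1) that by (simp add: common_zero_def)
  qed
  ultimately show ?thesis by (simp add: common_zero_def)
qed

lemma common_zero_at_0:
  fixes L :: "real^4^4"
  assumes "orthogonal_matrix L" "common_zero 0 L"
  obtains i where "L $ 1 $ i = 0" "L $ 3 $ i = 0" "L $ 4 $ i = 0"
proof (rule vertical_column_exists[of "($) (L $ 4)" "($) (L $ 1)" "($) (L $ 2)" "($) (L $ 3)"])
  fix i j :: 4
  show "L $ 4 $ i * L $ 4 $ j + L $ 1 $ i * L $ 1 $ j + L $ 2 $ i * L $ 2 $ j + L $ 3 $ i * L $ 3 $ j
      = (if i = j then 1 else 0)"
    using orthogonal_matrix_entries(1)[OF assms(1), of i j] by (simp add: sum_4)
next
  fix i j k :: 4
  assume "distinct [i, j, k]"
  then have "cubic_form 0 (column i L) (column j L) (column k L) = 0"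
    using assms(2) by (simp add: common_zero_def)
  then show "(3 * L $ 3 $ i * L $ 3 $ j - L $ 1 $ i * L $ 1 $ j) * L $ 4 $ k
      + (3 * L $ 3 $ i * L $ 3 $ k - L $ 1 $ i * L $ 1 $ k) * L $ 4 $ j
      + (3 * L $ 3 $ j * L $ 3 $ k - L $ 1 $ j * L $ 1 $ k) * L $ 4 $ i = 0"
    by (simp add: cubic_form_def column_def algebra_simps)
next
  fix i j k l :: 4
  assume "distinct [i, j, k, l]"
  then have "quartic_form (column i L) (column j L) (column k L) (column l L) = 0"
    using assms(2) by (simp add: common_zero_def)
  then show "L $ 4 $ i * L $ 4 $ j * (L $ 1 $ k * L $ 3 $ l + L $ 1 $ l * L $ 3 $ k)
      + L $ 4 $ i * L $ 4 $ k * (L $ 1 $ j * L $ 3 $ l + L $ 1 $ l * L $ 3 $ j)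
      + L $ 4 $ i * L $ 4 $ l * (L $ 1 $ j * L $ 3 $ k + L $ 1 $ k * L $ 3 $ j)
      + L $ 4 $ j * L $ 4 $ k * (L $ 1 $ i * L $ 3 $ l + L $ 1 $ l * L $ 3 $ i)
      + L $ 4 $ j * L $ 4 $ l * (L $ 1 $ i * L $ 3 $ k + L $ 1 $ k * L $ 3 $ i)
      + L $ 4 $ k * L $ 4 $ l * (L $ 1 $ i * L $ 3 $ j + L $ 1 $ j * L $ 3 $ i) = 0"
    by (simp add: quartic_form_def column_def algebra_simps)
qed (use that orthogonal_matrix_entries(2)[OF assms(1)] in auto)

section \<open>Blow-up at the vertical column\<close>

text \<open>With the column \<open>\<zeta> (w\<^sub>1, \<cdot>, w\<^sub>2, w\<^sub>3)\<close> and the parameter \<open>\<zeta> w\<^sub>4\<close>, the equations involving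
  that column are divisible by the small factor \<open>\<zeta>\<close>.\<close>

definition scaled_cubic :: "real^4 \<Rightarrow> real^4^4 \<Rightarrow> 4 \<Rightarrow> 4 \<Rightarrow> 4 \<Rightarrow> real" where
  "scaled_cubic w Q i j k =
     3 * (w$2 * (Q$3$j * Q$4$k + Q$4$j * Q$3$k) + w$3 * Q$3$j * Q$3$k)
     - (w$1 * (Q$1$j * Q$4$k + Q$4$j * Q$1$k) + w$3 * Q$1$j * Q$1$k)
     + w$4 * (Q$1$i * (Q$2$j * Q$3$k + Q$2$k * Q$3$j) + Q$2$i * (Q$1$j * Q$3$k + Q$1$k * Q$3$j)
        + Q$3$i * (Q$1$j * Q$2$k + Q$1$k * Q$2$j))"

definition scaled_quartic :: "real^4 \<Rightarrow> real^4^4 \<Rightarrow> 4 \<Rightarrow> 4 \<Rightarrow> 4 \<Rightarrow> real" where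
  "scaled_quartic w Q j k l =
     w$3 * (Q$4$j * (Q$1$k * Q$3$l + Q$1$l * Q$3$k) + Q$4$k * (Q$1$j * Q$3$l + Q$1$l * Q$3$j)
        + Q$4$l * (Q$1$j * Q$3$k + Q$1$k * Q$3$j))
     + w$1 * (Q$4$j * Q$4$k * Q$3$l + Q$4$j * Q$4$l * Q$3$k + Q$4$k * Q$4$l * Q$3$j)
     + w$2 * (Q$4$j * Q$4$k * Q$1$l + Q$4$j * Q$4$l * Q$1$k + Q$4$k * Q$4$l * Q$1$j)"

text \<open>Each monomial contains the parameter or an x, u or v entry of column i. In the terms
  with the parameter, the entries of column i stay unscaled, so that in the limit only its y entry
  survives there.\<close>

lemma cubic_form_scaled:
  assumes "Q $ 1 $ i = \<zeta> * w $ 1" "Q $ 3 $ i = \<zeta> * w $ 2" "Q $ 4 $ i = \<zeta> * w $ 3" "e = \<zeta> * w $ 4"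
  shows "cubic_form e (column i Q) (column j Q) (column k Q) = \<zeta> * scaled_cubic w Q i j k"
proof -
  have "cubic_form e (column i Q) (column j Q) (column k Q) =
     3 * (Q$3$i * (Q$3$j * Q$4$k + Q$4$j * Q$3$k) + Q$4$i * Q$3$j * Q$3$k)
     - (Q$1$i * (Q$1$j * Q$4$k + Q$4$j * Q$1$k) + Q$4$i * Q$1$j * Q$1$k)
     + e * (Q$1$i * (Q$2$j * Q$3$k + Q$2$k * Q$3$j) + Q$2$i * (Q$1$j * Q$3$k + Q$1$k * Q$3$j)
        + Q$3$i * (Q$1$j * Q$2$k + Q$1$k * Q$2$j))"
    by (simp add: cubic_form_def column_def algebra_simps)
  also have "\<dots> = \<zeta> * scaled_cubic w Q i j k"
    unfolding scaled_cubic_def assms(4) by (simp add: assms(1-3) algebra_simps)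
  finally show ?thesis .
qed

lemma quartic_form_scaled:
  assumes "Q $ 1 $ i = \<zeta> * w $ 1" "Q $ 3 $ i = \<zeta> * w $ 2" "Q $ 4 $ i = \<zeta> * w $ 3"
  shows "quartic_form (column i Q) (column j Q) (column k Q) (column l Q) = \<zeta> * scaled_quartic w Q j k l"
  by (simp add: quartic_form_def scaled_quartic_def column_def assms algebra_simps)

text \<open>Column i is plus or minus the y axis, so the other three columns have no y component and
  form an orthonormal frame of the (v, x, u)-space, to which \<open>rigid\<close> applies.\<close>

lemma no_scaled_solution:
  fixes L :: "real^4^4"
  assumes L: "orthogonal_matrix L" "common_zero 0 L" and i: "L $ 1 $ i = 0" "L $ 3 $ i = 0" "L $ 4 $ i = 0"
    and cubic: "\<And>j k. distinct [i, j, k] \<Longrightarrow> scaled_cubic w L i j k = 0"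
    and quartic: "\<And>j k l. distinct [i, j, k, l] \<Longrightarrow> scaled_quartic w L j k l = 0"
  shows "w = 0"
proof -
  obtain j k l :: 4 where d: "distinct [i, j, k, l]" and U: "UNIV = {i, j, k, l}" by (rule index_complement)
  note cols = orthogonal_matrix_entries(1)[OF L(1)] and rows = orthogonal_matrix_entries(2)[OF L(1)]
  have yi: "L $ 2 $ i * L $ 2 $ i = 1" using cols[of i i] by (simp add: sum_4 i)
  have y0: "L $ 2 $ a = 0" if "a \<noteq> i" for a
    using cols[of i a] that yi by (auto simp: sum_4 i)
  let ?I = "UNIV - {i}"
  have I: "?I = {j, k, l}" using U d by auto
  interpret orthonormal_frame ?I "($) (L $ 4)" "($) (L $ 1)" "($) (L $ 3)"
  proof
    fix a b assume "a \<in> ?I" "b \<in> ?I"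
    then show "L $ 4 $ a * L $ 4 $ b + L $ 1 $ a * L $ 1 $ b + L $ 3 $ a * L $ 3 $ b = (if a = b then 1 else 0)"
      using cols[of a b] by (simp add: sum_4 y0)
  qed (use rows in \<open>simp_all add: sum_diff1 i\<close>)
  \<comment> \<open>The entry \<open>L $ 2 $ i\<close>, which is 1 or -1, is absorbed into the
    parameter of \<open>rigid\<close>.\<close>
  have "w $ 1 = 0 \<and> w $ 2 = 0 \<and> w $ 3 = 0 \<and> w $ 4 * L $ 2 $ i = 0"
  proof (rule rigid[of j k l])
    fix a b assume ab: "a \<in> ?I" "b \<in> ?I" "a \<noteq> b"
    then have "scaled_cubic w L i a b = 0" by (intro cubic) auto
    then show "qform (- (w $ 1)) (3 * w $ 2) (- (w $ 3)) (3 * w $ 3) (w $ 4 * L $ 2 $ i) a b = 0"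
      unfolding qform_def scaled_cubic_def by (simp add: i algebra_simps)
  next
    have "cubic_form 0 (column j L) (column k L) (column l L) = 0"
      using L(2) d by (simp add: common_zero_def)
    then show "3 * (L $ 3 $ j * L $ 3 $ k * L $ 4 $ l + L $ 3 $ j * L $ 4 $ k * L $ 3 $ l + L $ 4 $ j * L $ 3 $ k * L $ 3 $ l)
      = L $ 1 $ j * L $ 1 $ k * L $ 4 $ l + L $ 1 $ j * L $ 4 $ k * L $ 1 $ l + L $ 4 $ j * L $ 1 $ k * L $ 1 $ l"
      by (simp add: cubic_form_def column_def)
  qed (use I d quartic[of j k l] in \<open>simp_all add: scaled_quartic_def\<close>)
  moreover have "L $ 2 $ i \<noteq> 0" using yi by auto
  ultimately show ?thesis by (simp add: vec_eq_iff forall_4)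
qed

text \<open>Compactness is used twice: for the matrices as the parameter tends to 0, and for the
  normalized small quantities attached to the column that becomes vertical. The second limit would
  be a unit vector solving the linearized system.\<close>

lemma exists_parameter_without_common_zero: "\<exists>e. \<forall>Q. orthogonal_matrix Q \<longrightarrow> \<not> common_zero e Q"
proof (rule ccontr)
  assume "\<not> ?thesis"
  then have "\<forall>n. \<exists>Q. orthogonal_matrix Q \<and> common_zero (inverse (real (Suc n))) Q" by blast
  then obtain Q0 where Q0: "\<And>n. orthogonal_matrix (Q0 n)" "\<And>n. common_zero (inverse (real (Suc n))) (Q0 n)"
    by metis
  have "bounded (range Q0)"
    using bounded_orthogonal_matrices by (rule bounded_subset) (use Q0(1) in auto)
  then obtain L r where r: "strict_mono r" and lim0: "(Q0 \<circ> r) \<longlonglongrightarrow> L"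
    using bounded_imp_convergent_subsequence by blast
  define Q e where "Q = Q0 \<circ> r" and "e = (\<lambda>n. inverse (real (Suc (r n))))"
  have Q: "\<And>n. orthogonal_matrix (Q n)" "\<And>n. common_zero (e n) (Q n)" "Q \<longlonglongrightarrow> L"
    using Q0 lim0 by (simp_all add: Q_def e_def)
  have e: "e \<longlonglongrightarrow> 0" "e n > 0" for n
    using LIMSEQ_subseq_LIMSEQ[OF LIMSEQ_inverse_real_of_nat r] by (simp_all add: e_def o_def)
  have L: "orthogonal_matrix L" "common_zero 0 L"
    using closed_orthogonal_matrix[OF Q(1,3)] common_zero_limit[OF Q(2) e(1) Q(3)] .
  then obtain i where i: "L $ 1 $ i = 0" "L $ 3 $ i = 0" "L $ 4 $ i = 0" by (rule common_zero_at_0)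
  \<comment> \<open>The quantities tending to 0, in the order x, u, v, parameter. Including the
    positive parameter guarantees that the vector can be normalized.\<close>
  define z :: "nat \<Rightarrow> real^4" where "z n = vector [Q n $ 1 $ i, Q n $ 3 $ i, Q n $ 4 $ i, e n]" for n
  have z: "z n $ 1 = Q n $ 1 $ i" "z n $ 2 = Q n $ 3 $ i" "z n $ 3 = Q n $ 4 $ i" "z n $ 4 = e n" for n
    by (simp_all add: z_def vector_4)
  have z0: "z n \<noteq> 0" for n using z(4)[of n] e(2)[of n] by auto
  define w where "w n = z n /\<^sub>R norm (z n)" for n
  have w: "norm (w n) = 1" "z n = norm (z n) *\<^sub>R w n" for n using z0 by (simp_all add: w_def)
  have "bounded (range w)" unfolding bounded_iff using w(1) by (metis order_refl rangeE)
  then obtain W r' where r': "strict_mono r'" and limw: "(w \<circ> r') \<longlonglongrightarrow> W"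
    using bounded_imp_convergent_subsequence by blast
  have limQ: "(\<lambda>n. Q (r' n)) \<longlonglongrightarrow> L" using LIMSEQ_subseq_LIMSEQ[OF Q(3) r'] by (simp add: o_def)
  have limw': "(\<lambda>n. w (r' n)) \<longlonglongrightarrow> W" using limw by (simp add: o_def)
  have entries: "Q n $ 1 $ i = norm (z n) * w n $ 1" "Q n $ 3 $ i = norm (z n) * w n $ 2"
    "Q n $ 4 $ i = norm (z n) * w n $ 3" "e n = norm (z n) * w n $ 4" for n
    using arg_cong[OF w(2)[of n], of "\<lambda>p. p $ 1"] arg_cong[OF w(2)[of n], of "\<lambda>p. p $ 2"]
      arg_cong[OF w(2)[of n], of "\<lambda>p. p $ 3"] arg_cong[OF w(2)[of n], of "\<lambda>p. p $ 4"]
    by (simp_all add: z)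
  have "scaled_cubic W L i j k = 0" if d: "distinct [i, j, k]" for j k
  proof (rule LIMSEQ_unique)
    show "(\<lambda>n. scaled_cubic (w (r' n)) (Q (r' n)) i j k) \<longlonglongrightarrow> scaled_cubic W L i j k"
      unfolding scaled_cubic_def by (intro tendsto_intros limQ limw')
    have "scaled_cubic (w n) (Q n) i j k = 0" for n
    proof -
      have "norm (z n) * scaled_cubic (w n) (Q n) i j k = 0"
        using cubic_form_scaled[of "Q n" i "norm (z n)" "w n" "e n" j k] entries Q(2)[of n] d
        by (simp add: common_zero_def)
      then show ?thesis using z0 by simp
    qed
    then show "(\<lambda>n. scaled_cubic (w (r' n)) (Q (r' n)) i j k) \<longlonglongrightarrow> 0" by simp
  qed
  moreover have "scaled_quartic W L j k l = 0" if d: "distinct [i, j, k, l]" for j k l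
  proof (rule LIMSEQ_unique)
    show "(\<lambda>n. scaled_quartic (w (r' n)) (Q (r' n)) j k l) \<longlonglongrightarrow> scaled_quartic W L j k l"
      unfolding scaled_quartic_def by (intro tendsto_intros limQ limw')
    have "scaled_quartic (w n) (Q n) j k l = 0" for n
    proof -
      have "norm (z n) * scaled_quartic (w n) (Q n) j k l = 0"
        using quartic_form_scaled[of "Q n" i "norm (z n)" "w n" j k l] entries Q(2)[of n] d
        by (simp add: common_zero_def)
      then show ?thesis using z0 by simp
    qed
    then show "(\<lambda>n. scaled_quartic (w (r' n)) (Q (r' n)) j k l) \<longlonglongrightarrow> 0" by simp
  qed
  ultimately have "W = 0" by (rule no_scaled_solution[OF L i])
  moreover have "norm W = 1"
    using tendsto_norm[OF limw'] w(1) by (simp add: LIMSEQ_const_iff)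
  ultimately show False by simp
qed

theorem theorem2:
  shows "\<exists>A \<in> (sym_forms :: ((real^4)^3 \<Rightarrow> real) set).
         \<exists>B \<in> (sym_forms :: ((real^4)^4 \<Rightarrow> real) set).
           \<not> (\<exists>Q :: real^4^4. orthogonal_matrix Q \<and> form_map A B Q = 0)"
proof -
  obtain e where "\<And>Q. orthogonal_matrix Q \<Longrightarrow> \<not> common_zero e Q"
    using exists_parameter_without_common_zero by blast
  then show ?thesis
    using cubic_form_in_sym_forms[of e] quartic_form_in_sym_forms common_zeroI by blast
qed

end
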